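(* Let $x\ge1$ be real. The series $$\sum_{j=0}^\infty\frac{q^{C_j}}{a_j(q)a_{j+1}(q)}$$ (which is $q$-adically equal to $1/[x]_q$) converges absolutely on the region $D$ and uniformly on its compact subsets to a nonvanishing holomorphic function $\psi_x(q)$. In particular, $\psi_x(q)$ is analytic on $(-3+2\sqrt2,1)$. Moreover, for $q\in D$ and $N\ge1$, with $r=|q|$, $a=a(q)$, and $[x]_q$ denoting the value $1/\psi_x(q)$, $$\left|\frac{1}{[x]_{N,q}}-\frac{1}{[x]_q}\right|\le\frac{r^{-1/2}a}{1-a^2}\,r^{\sum_{i=1}^N(c_i-2)}a^{2N}$$ and $$\bigl|[x]_{N,q}-[x]_q\bigr|\le\frac{r^{-1/2}a}{1-a^2}\,r^{\sum_{i=1}^N(c_i-2)}a^{2N-2}.$$ The right-hand sides at $q=0$ are interpreted by continuous extension. With the convention $1/[x]_{0,q}:=0$, the first inequality is valid for $N=0$ as well.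
   Context: For an integer $n\ge 0$ put $[n]_q=\frac{1-q^n}{1-q}$. Every real $x\ge1$ has a unique expansion $x=[[c_1,c_2,\ldots]]:=c_1-\frac{1}{c_2-\frac{1}{c_3-\cdots}}$ with integers $c_j\ge2$ (rational $x$ correspond to sequences eventually equal to $2$). Set $[x]_{N,q}:=[c_1]_q-\frac{q^{c_1-1}}{[c_2]_q-\cdots\frac{q^{c_{N-1}-1}}{[c_N]_q}}$ for $N\ge 1$; $[x]_q\in\mathbb Z[[q]]$ is the $q$-adic limit of $[x]_{N,q}$ as $N\to\infty$. Define polynomials $a_0(q)=1$, $a_1(q)=[c_1]_q$, $a_N(q)=[c_N]_q\,a_{N-1}(q)-q^{c_{N-1}-1}a_{N-2}(q)$ for $N\ge2$, and $C_N:=\sum_{j=1}^N(c_j-1)$ (so $C_0=0$). $D\subset\mathbb C$ is the open region containing $0$ consisting of all $re^{i\theta}$, $0\le\theta\le2\pi$, with $0\le r<1+2\sin\frac\theta2-2\sqrt{\sin\frac\theta2(1+\sin\frac\theta2)}$. For $q=re^{i\theta}\in D\setminus\{0\}$ (with $r=|q|$), the number $a=a(q)$ is the unique solution with $0<a<1$ of $$\frac{r^{-1}-r}{\sqrt{r+r^{-1}-2\cos\theta}}=a+\frac1a,$$ and $a(0):=0$. This is a continuous function on $D$, and $r^{-1/2}a(q)\to1$ as $q\to0$, so $r^{-1/2}a$ is understood to equal $1$ at $q=0$. *)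

theory Defs
  imports
    "HOL-Complex_Analysis.Complex_Analysis"
    "HOL-Computational_Algebra.Formal_Power_Series"
begin

section \<open>Negative continued fractions\<close>

text \<open>
  Digit sequences are indexed from 1. The value \<open>ncf c k n\<close> is the finite continued fraction
  \<open>c k - 1 / (c (k+1) - \<dots> - 1 / c (k+n))\<close>, which involves \<open>n + 1\<close> digits.
\<close>

primrec ncf :: "(nat \<Rightarrow> nat) \<Rightarrow> nat \<Rightarrow> nat \<Rightarrow> real" where
  "ncf c k 0 = real (c k)"
| "ncf c k (Suc n) = real (c k) - 1 / ncf c (Suc k) n"

definition ncf_expansion :: "(nat \<Rightarrow> nat) \<Rightarrow> real \<Rightarrow> bool" where
  "ncf_expansion c x \<longleftrightarrow> (\<forall>j\<ge>1. 2 \<le> c j) \<and> (\<lambda>n. ncf c 1 n) \<longlonglongrightarrow> x"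

text \<open>
  The unused entry \<open>c 0\<close> is set to 0 so that the sequence is unique as a function on \<^typ>\<open>nat\<close>.
\<close>

definition ncf_digits :: "real \<Rightarrow> nat \<Rightarrow> nat" where
  "ncf_digits x = (THE c. c 0 = 0 \<and> ncf_expansion c x)"

lemma ncf_ge:
  assumes "\<And>j. j \<ge> k \<Longrightarrow> 2 \<le> c j"
  shows "ncf c k n \<ge> (real n + 2) / (real n + 1)"
  using assms
proof (induction n arbitrary: k)
  case 0
  from "0.prems"[of k] show ?case by simp
next
  case (Suc n)
  have IH: "ncf c (Suc k) n \<ge> (real n + 2) / (real n + 1)"
    using Suc.prems by (intro Suc.IH) auto
  have "1 / ncf c (Suc k) n \<le> 1 / ((real n + 2) / (real n + 1))"
  proof (rule divide_left_mono[OF IH])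
    have "0 < (real n + 2) / (real n + 1)" by simp
    moreover from this IH have "0 < ncf c (Suc k) n" by linarith
    ultimately show "0 < ncf c (Suc k) n * ((real n + 2) / (real n + 1))"
      by (rule mult_pos_pos[rotated])
  qed simp
  moreover have "real (c k) \<ge> 2"
    using Suc.prems[of k] by simp
  moreover have "2 - 1 / ((real n + 2) / (real n + 1)) = (real (Suc n) + 2) / (real (Suc n) + 1)"
    by (simp add: field_simps)
  ultimately show ?case by simp
qed

lemma ncf_ge_1:
  assumes "\<And>j. j \<ge> k \<Longrightarrow> 2 \<le> c j"
  shows "ncf c k n \<ge> 1"
proof -
  have "1 \<le> (real n + 2) / (real n + 1)" by simp
  also have "\<dots> \<le> ncf c k n" using assms by (rule ncf_ge)
  finally show ?thesis .
qed

lemma ncf_tendsto_step: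
  assumes c: "\<And>j. j \<ge> k \<Longrightarrow> 2 \<le> c j" and lim: "ncf c k \<longlonglongrightarrow> x"
  shows "int (c k) = \<lfloor>x\<rfloor> + 1" and "ncf c (Suc k) \<longlonglongrightarrow> 1 / (real (c k) - x)"
proof -
  have ge1: "ncf c (Suc k) n \<ge> 1" for n
    by (rule ncf_ge_1) (use c in auto)
  have le: "ncf c (Suc k) n \<le> real (c (Suc k))" for n
    using ncf_ge_1[of "Suc (Suc k)" c] c by (cases n) (auto, smt (verit) Suc_leD divide_nonneg_nonneg)
  have c1: "real (c (Suc k)) > 0"
    using c[of "Suc k"] by simp
  have "(\<lambda>n. ncf c k (Suc n)) \<longlonglongrightarrow> x"
    using lim by (rule LIMSEQ_Suc)
  hence "(\<lambda>n. real (c k) - ncf c k (Suc n)) \<longlonglongrightarrow> real (c k) - x"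
    by (intro tendsto_intros)
  hence inv: "(\<lambda>n. 1 / ncf c (Suc k) n) \<longlonglongrightarrow> real (c k) - x"
    by simp
  have "1 / real (c (Suc k)) \<le> 1 / ncf c (Suc k) n" for n
    using le[of n] ge1[of n] by (intro divide_left_mono) auto
  hence "1 / real (c (Suc k)) \<le> real (c k) - x"
    by (intro LIMSEQ_le_const[OF inv]) auto
  moreover have "1 / real (c (Suc k)) > 0"
    using c1 by simp
  ultimately have pos: "real (c k) - x > 0" by linarith
  have "real (c k) - x \<le> 1"
  proof (rule LIMSEQ_le_const2[OF inv], intro exI allI impI)
    show "1 / ncf c (Suc k) n \<le> 1" for n using ge1[of n] by simp
  qed
  with pos show "int (c k) = \<lfloor>x\<rfloor> + 1" by linarith
  have "(\<lambda>n. 1 / (1 / ncf c (Suc k) n)) \<longlonglongrightarrow> 1 / (real (c k) - x)"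
    using pos by (intro tendsto_intros inv) auto
  thus "ncf c (Suc k) \<longlonglongrightarrow> 1 / (real (c k) - x)" by simp
qed

lemma ncf_expansion_unique:
  assumes "ncf_expansion c x" "ncf_expansion c' x" "j \<ge> 1"
  shows "c j = c' j"
proof -
  from assms have ge: "\<And>j. j \<ge> 1 \<Longrightarrow> 2 \<le> c j" "\<And>j. j \<ge> 1 \<Longrightarrow> 2 \<le> c' j"
    by (auto simp: ncf_expansion_def)
  have "\<exists>y. ncf c (Suc k) \<longlonglongrightarrow> y \<and> ncf c' (Suc k) \<longlonglongrightarrow> y" for k
  proof (induction k)
    case 0
    then show ?case using assms by (auto simp: ncf_expansion_def)
  next
    case (Suc k)
    then obtain y where y: "ncf c (Suc k) \<longlonglongrightarrow> y" "ncf c' (Suc k) \<longlonglongrightarrow> y" by blast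
    have "int (c (Suc k)) = \<lfloor>y\<rfloor> + 1" "int (c' (Suc k)) = \<lfloor>y\<rfloor> + 1"
      using ncf_tendsto_step(1)[OF _ y(1)] ncf_tendsto_step(1)[OF _ y(2)] ge by auto
    hence "c (Suc k) = c' (Suc k)" by simp
    with ncf_tendsto_step(2)[OF _ y(1)] ncf_tendsto_step(2)[OF _ y(2)] ge show ?case by auto
  qed
  then obtain y where y: "ncf c j \<longlonglongrightarrow> y" "ncf c' j \<longlonglongrightarrow> y"
    using assms(3) by (metis Suc_pred' less_eq_Suc_le One_nat_def)
  have "int (c j) = \<lfloor>y\<rfloor> + 1" "int (c' j) = \<lfloor>y\<rfloor> + 1"
    using ncf_tendsto_step(1)[OF _ y(1)] ncf_tendsto_step(1)[OF _ y(2)] ge assms(3) by auto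
  thus ?thesis by simp
qed

lemma ncf_expansion_exists:
  assumes "x \<ge> 1"
  shows "\<exists>c. c 0 = 0 \<and> ncf_expansion c x"
proof -
  define X where "X = rec_nat x (\<lambda>_ y. 1 / (of_int \<lfloor>y\<rfloor> + 1 - y))"
  have X_0: "X 0 = x" and X_Suc: "X (Suc n) = 1 / (of_int \<lfloor>X n\<rfloor> + 1 - X n)" for n
    by (simp_all add: X_def)
  define c where "c = (\<lambda>j. if j = 0 then 0 else nat (\<lfloor>X (j - 1)\<rfloor> + 1))"
  have X_ge: "X n \<ge> 1" for n
  proof (induction n)
    case 0
    show ?case using assms by (simp add: X_0)
  next
    case (Suc n)
    have "of_int \<lfloor>X n\<rfloor> + 1 - X n > 0" "of_int \<lfloor>X n\<rfloor> + 1 - X n \<le> 1" by linarith+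
    thus ?case by (simp add: X_Suc)
  qed
  have c_eq: "real (c (Suc k)) = of_int \<lfloor>X k\<rfloor> + 1" for k
    using X_ge[of k] by (simp add: c_def)
  have c_ge: "2 \<le> c j" if "j \<ge> 1" for j
  proof -
    have "\<lfloor>X (j - 1)\<rfloor> \<ge> 1" using X_ge[of "j - 1"] by simp
    hence "2 \<le> nat (\<lfloor>X (j - 1)\<rfloor> + 1)" by linarith
    thus ?thesis using that by (simp add: c_def)
  qed
  have X_eq: "X k = real (c (Suc k)) - 1 / X (Suc k)" for k
    by (simp add: c_eq X_Suc)
  have bound: "X k \<le> ncf c (Suc k) n \<and> ncf c (Suc k) n - X k \<le> 1 / (real n + 1)" for k n
  proof (induction n arbitrary: k)
    case 0
    have "X k \<le> of_int \<lfloor>X k\<rfloor> + 1" "of_int \<lfloor>X k\<rfloor> + 1 - X k \<le> 1" by linarith+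
    thus ?case by (simp add: c_eq)
  next
    case (Suc n)
    define F where "F = ncf c (Suc (Suc k)) n"
    define Y where "Y = X (Suc k)"
    have F: "F \<ge> (real n + 2) / (real n + 1)" "Y \<ge> 1"
      unfolding F_def Y_def by (rule ncf_ge, use c_ge in simp) (rule X_ge)
    have IH: "Y \<le> F" "F - Y \<le> 1 / (real n + 1)"
      using Suc.IH[of "Suc k"] by (auto simp: F_def Y_def)
    have eq: "ncf c (Suc k) (Suc n) - X k = 1 / Y - 1 / F"
      using X_eq[of k] by (simp add: F_def Y_def)
    also have "\<dots> = (F - Y) / (F * Y)"
      using F(2) IH(1) by (simp add: field_simps)
    finally have eq': "ncf c (Suc k) (Suc n) - X k = (F - Y) / (F * Y)" .
    have "(F - Y) / (F * Y) \<le> (1 / (real n + 1)) / ((real n + 2) / (real n + 1) * 1)"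
      using F IH by (intro frac_le mult_mono) auto
    also have "\<dots> = 1 / (real (Suc n) + 1)"
      by (simp add: field_simps)
    finally have "ncf c (Suc k) (Suc n) - X k \<le> 1 / (real (Suc n) + 1)" by (simp only: eq')
    moreover have "(F - Y) / (F * Y) \<ge> 0" using F IH by simp
    ultimately show ?case using eq' by linarith
  qed
  have "(\<lambda>n. ncf c 1 n) \<longlonglongrightarrow> x"
  proof (rule tendsto_sandwich)
    show "\<forall>\<^sub>F n in sequentially. x \<le> ncf c 1 n"
      using bound[of 0] by (simp add: X_0)
    show "\<forall>\<^sub>F n in sequentially. ncf c 1 n \<le> x + inverse (real (Suc n))"
      using bound[of 0] by (intro always_eventually allI) (simp add: X_0 field_simps)
    show "(\<lambda>n. x + inverse (real (Suc n))) \<longlonglongrightarrow> x"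
      using tendsto_add[OF tendsto_const[of x] LIMSEQ_inverse_real_of_nat] by simp
  qed simp
  moreover have "c 0 = 0" by (simp add: c_def)
  ultimately show ?thesis using c_ge by (auto simp: ncf_expansion_def)
qed

lemma ncf_digits_unique_existence:
  assumes "x \<ge> 1"
  shows "\<exists>!c. c 0 = 0 \<and> ncf_expansion c x"
proof -
  obtain c where c: "c 0 = 0" "ncf_expansion c x"
    using ncf_expansion_exists[OF assms] by blast
  moreover have "c' = c" if "c' 0 = 0" "ncf_expansion c' x" for c'
  proof
    fix j show "c' j = c j"
      using c that ncf_expansion_unique[OF that(2) c(2), of j] by (cases j) auto
  qed
  ultimately show ?thesis by blast
qed


section \<open>The q-deformation\<close>

text \<open>
  These definitions are used both for a complex number \<open>q\<close> and for the formal variable \<^const>\<open>fps_X\<close>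
  over the rationals. At the complex number \<open>q = 1\<close> the quotient in \<open>q_int\<close> is 0 and not \<open>n\<close>, but this
  point is outside the region of convergence.
\<close>

definition q_int :: "nat \<Rightarrow> 'a::{comm_ring_1,inverse} \<Rightarrow> 'a" where
  "q_int n q = (1 - q ^ n) / (1 - q)"

primrec q_ncf :: "(nat \<Rightarrow> nat) \<Rightarrow> nat \<Rightarrow> nat \<Rightarrow> 'a::{comm_ring_1,inverse} \<Rightarrow> 'a" where
  "q_ncf c k 0 q = q_int (c k) q"
| "q_ncf c k (Suc n) q = q_int (c k) q - q ^ (c k - 1) / q_ncf c (Suc k) n q"

text \<open>\<open>q_real_trunc x N q\<close> is \<open>[x]\<^bsub>N,q\<^esub>\<close>; it is meaningful only for \<open>N \<ge> 1\<close>.\<close>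

definition q_real_trunc :: "real \<Rightarrow> nat \<Rightarrow> 'a::{comm_ring_1,inverse} \<Rightarrow> 'a" where
  "q_real_trunc x N q = q_ncf (ncf_digits x) 1 (N - 1) q"

text \<open>The topology on formal power series is the q-adic one.\<close>

definition q_real_fps :: "real \<Rightarrow> rat fps" where
  "q_real_fps x = lim (\<lambda>N. q_real_trunc x N fps_X)"

text \<open>
  \<open>q_num x N q\<close> is the polynomial \<open>a\<^sub>N(q)\<close>, the numerator of the truncation \<open>q_real_trunc x N q\<close>, and
  \<open>q_exponent x N\<close> is \<open>C\<^sub>N\<close>.
\<close>

fun q_num :: "real \<Rightarrow> nat \<Rightarrow> 'a::{comm_ring_1,inverse} \<Rightarrow> 'a" where
  "q_num x 0 q = 1"
| "q_num x (Suc 0) q = q_int (ncf_digits x 1) q"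
| "q_num x (Suc (Suc n)) q =
     q_int (ncf_digits x (n + 2)) q * q_num x (Suc n) q
       - q ^ (ncf_digits x (n + 1) - 1) * q_num x n q"

definition q_exponent :: "real \<Rightarrow> nat \<Rightarrow> nat" where
  "q_exponent x N = (\<Sum>j = 1..N. ncf_digits x j - 1)"

definition psi_term :: "real \<Rightarrow> 'a::{comm_ring_1,inverse} \<Rightarrow> nat \<Rightarrow> 'a" where
  "psi_term x q j = q ^ q_exponent x j / (q_num x j q * q_num x (Suc j) q)"

definition psi :: "real \<Rightarrow> complex \<Rightarrow> complex" where
  "psi x q = (\<Sum>j. psi_term x q j)"

definition q_real :: "real \<Rightarrow> complex \<Rightarrow> complex" where
  "q_real x q = 1 / psi x q"


section \<open>The region of convergence and the error bound\<close>

definition region_D :: "complex set" where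
  "region_D = {rcis r \<theta> | r \<theta>. 0 \<le> \<theta> \<and> \<theta> \<le> 2 * pi \<and> 0 \<le> r \<and>
     r < 1 + 2 * sin (\<theta> / 2) - 2 * sqrt (sin (\<theta> / 2) * (1 + sin (\<theta> / 2)))}"

definition a_fun :: "complex \<Rightarrow> real" where
  "a_fun q =
     (if q = 0 then 0
      else THE a. 0 < a \<and> a < 1 \<and>
        (1 / norm q - norm q) / sqrt (norm q + 1 / norm q - 2 * cos (Arg q)) = a + 1 / a)"

text \<open>
  The function \<open>r\<^bsup>-1/2\<^esup> a\<close> with its limit value 1 at \<open>q = 0\<close>. The remaining factors of the error bounds
  are powers with natural number exponents, so \<open>0 ^ 0 = 1\<close> gives their continuous extensions to 0.
\<close>

definition a_ratio :: "complex \<Rightarrow> real" where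
  "a_ratio q = (if q = 0 then 1 else norm q powr (- 1 / 2) * a_fun q)"

end

theory Submission
  imports Defs
begin

text \<open>
  Write \<open>r = |q|\<close> and \<open>h = (1 - r\<^sup>2) / |1 - q|\<close>. Every digit is at least 2, so every
  \<open>q\<close>-integer that occurs satisfies \<open>|[c]\<^sub>q| = |1 - q\<^sup>c| / |1 - q| \<ge> h\<close>, and the
  power of \<open>q\<close> that accompanies it in the recursion has modulus at most \<open>r\<close>. Hence the whole
  analysis is governed by the recursion \<open>t \<mapsto> h - r / t\<close> on positive reals. It has a fixed point
  exactly when \<open>h\<^sup>2 \<ge> 4 r\<close>. Elementary trigonometry shows that the region \<open>D\<close> consists of the points
  with \<open>r < 1\<close> and \<open>h\<^sup>2 > 4 r\<close> (\<open>region_D_eq\<close>). On \<open>D\<close> let \<open>g\<close> be the larger fixed point,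
  so that \<open>h = g + r / g\<close> and \<open>r < g\<^sup>2\<close>. The equation that determines \<open>a(q)\<close> says
  \<open>h / \<surd>r = a + 1 / a\<close>, whence \<open>a = \<surd>r / g\<close> and \<open>r\<^bsup>-1/2\<^esup> a = 1 / g\<close>.

  If a quantity \<open>t\<close> has modulus at least \<open>g\<close>, then so does \<open>[c]\<^sub>q - q\<^bsup>d-1\<^esup> / t\<close> for all digits
  \<open>c\<close> and \<open>d\<close> (\<open>recursion_step_norm_ge\<close>). Applied to the quotients of consecutive polynomials \<open>a\<^sub>N\<close>, this gives
  \<open>|a\<^sub>N| \<ge> g\<^sup>N\<close> and hence the bound
  \<open>|q\<^bsup>C\<^esup> / (a\<^sub>j a\<^bsub>j+1\<^esub>)| \<le> (1 / g) r\<^bsup>C-j\<^esup> a\<^bsup>2j\<^esup>\<close>, with \<open>C = C\<^sub>j\<close>, on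
  the terms of the series. Summing the geometric tail gives convergence and the first error bound,
  because the partial sums are the reciprocals of the truncations. On a compact set \<open>1 / g\<close> and
  \<open>a\<^sup>2 = r / g\<^sup>2\<close> attain their maxima, so one geometric series dominates there and the sum is
  holomorphic.

  That the partial sums are these reciprocals is a consequence of the classical determinant identity
  for continuants (\<open>q_continuant_determinant\<close>). It also turns the recursion of
  the finite fractions into \<open>F\<^sub>n = [c\<^sub>1]\<^sub>q - q\<^bsup>c-1\<^esup> S'\<^sub>n\<close>, with \<open>c = c\<^sub>1\<close>, where \<open>F\<^sub>n\<close>
  is the fraction with \<open>n + 1\<close> digits and \<open>S'\<^sub>n\<close> is the partial sum of the series that belongs to the
  digits \<open>c\<^sub>2, c\<^sub>3, \<dots>\<close>. In the limit \<open>\<psi> ([c\<^sub>1]\<^sub>q - q\<^bsup>c-1\<^esup> \<psi>') = 1\<close>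
  (\<open>infinite_fraction_rec\<close>): the sum of
  the series cannot vanish, and the error of the truncations is the error of the shifted
  series times \<open>q\<^bsup>c-1\<^esup>\<close>, so the second error bound follows from the first. For this reason all
  notions below carry an index \<open>k\<close> for the first digit. The same algebra holds for formal power
  series, where the series converges because the \<open>j\<close>-th term is divisible by the \<open>j\<close>-th power of
  the variable.
\<close>

section \<open>Continuants\<close>

fun q_continuant :: "(nat \<Rightarrow> nat) \<Rightarrow> nat \<Rightarrow> nat \<Rightarrow> 'a::{comm_ring_1,inverse} \<Rightarrow> 'a" where
  "q_continuant c k 0 q = 1"
| "q_continuant c k (Suc 0) q = q_int (c k) q"
| "q_continuant c k (Suc (Suc n)) q =
     q_int (c (k + n + 1)) q * q_continuant c k (Suc n) q
       - q ^ (c (k + n) - 1) * q_continuant c k n q"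

definition q_term :: "(nat \<Rightarrow> nat) \<Rightarrow> nat \<Rightarrow> 'a::{comm_ring_1,inverse} \<Rightarrow> nat \<Rightarrow> 'a" where
  "q_term c k q j =
     q ^ (\<Sum>i<j. c (k + i) - 1) / (q_continuant c k j q * q_continuant c k (Suc j) q)"

lemma q_num_eq_continuant: "q_num x n q = q_continuant (ncf_digits x) 1 n q"
  by (induction x n q rule: q_num.induct) simp_all

lemma q_exponent_eq: "q_exponent x n = (\<Sum>i<n. ncf_digits x (1 + i) - 1)"
  by (simp add: q_exponent_def sum.atLeast1_atMost_eq)

lemma psi_term_eq_q_term: "psi_term x = q_term (ncf_digits x) 1"
  by (intro ext)
    (simp only: psi_term_def q_term_def q_exponent_eq q_num_eq_continuant)

text \<open>
  A continuant can be expanded at its first digit as well as at its last one. The definition gives the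
  second expansion, while the continued fraction is built up by the first.
\<close>

lemma q_continuant_left_rec:
  "q_continuant c k (Suc (Suc n)) q =
     q_int (c k) q * q_continuant c (Suc k) (Suc n) q
       - q ^ (c k - 1) * q_continuant c (Suc (Suc k)) n q"
proof (induction n rule: nat_less_induct)
  case (1 n)
  consider "n = 0" | "n = 1" | m where "n = Suc (Suc m)"
    by (metis One_nat_def not0_implies_Suc)
  then show ?case
  proof cases
    case 3
    have IH0: "q_continuant c k (Suc (Suc m)) q =
        q_int (c k) q * q_continuant c (Suc k) (Suc m) q
        - q ^ (c k - 1) * q_continuant c (Suc (Suc k)) m q"
      using "1.IH" 3 by simp
    have IH1: "q_continuant c k (Suc (Suc (Suc m))) q =
        q_int (c k) q * q_continuant c (Suc k) (Suc (Suc m)) q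
        - q ^ (c k - 1) * q_continuant c (Suc (Suc k)) (Suc m) q"
      using "1.IH" 3 by blast
    have rec: "q_continuant c k (Suc (Suc n)) q =
        q_int (c (k + m + 3)) q * q_continuant c k (Suc (Suc (Suc m))) q
          - q ^ (c (k + m + 2) - 1) * q_continuant c k (Suc (Suc m)) q"
      "q_continuant c (Suc k) (Suc n) q =
        q_int (c (k + m + 3)) q * q_continuant c (Suc k) (Suc (Suc m)) q
          - q ^ (c (k + m + 2) - 1) * q_continuant c (Suc k) (Suc m) q"
      "q_continuant c (Suc (Suc k)) n q =
        q_int (c (k + m + 3)) q * q_continuant c (Suc (Suc k)) (Suc m) q
          - q ^ (c (k + m + 2) - 1) * q_continuant c (Suc (Suc k)) m q"
      using q_continuant.simps(3)[of c k "Suc (Suc m)"]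
        q_continuant.simps(3)[of c "Suc k" "Suc m"]
        q_continuant.simps(3)[of c "Suc (Suc k)" m]
      unfolding 3 by (simp_all del: q_continuant.simps add: eval_nat_numeral)
    show ?thesis
      unfolding rec IH0 IH1 by (simp only: algebra_simps)
  qed (simp_all add: algebra_simps)
qed

text \<open>
  Both sequences \<open>q_continuant c (Suc k)\<close> and \<open>q_continuant c k\<close> satisfy the same second order
  recursion, so each step multiplies their determinant by the coefficient of the older term, a power
  of \<open>q\<close>.
\<close>

lemma q_continuant_determinant:
  "q_continuant c (Suc k) (Suc n) q * q_continuant c k (Suc n) q
     - q_continuant c (Suc k) n q * q_continuant c k (Suc (Suc n)) q
   = q ^ (\<Sum>i<Suc n. c (k + i) - 1)"
proof (induction n)
  case 0
  show ?case by (simp add: algebra_simps)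
next
  case (Suc n)
  have rec: "q_continuant c (Suc k) (Suc (Suc n)) q =
        q_int (c (k + n + 2)) q * q_continuant c (Suc k) (Suc n) q
          - q ^ (c (k + n + 1) - 1) * q_continuant c (Suc k) n q"
      "q_continuant c k (Suc (Suc (Suc n))) q =
        q_int (c (k + n + 2)) q * q_continuant c k (Suc (Suc n)) q
          - q ^ (c (k + n + 1) - 1) * q_continuant c k (Suc n) q"
    using q_continuant.simps(3)[of c "Suc k" n]
        q_continuant.simps(3)[of c k "Suc n"]
    by (simp_all del: q_continuant.simps)
  have "q_continuant c (Suc k) (Suc (Suc n)) q * q_continuant c k (Suc (Suc n)) q
      - q_continuant c (Suc k) (Suc n) q * q_continuant c k (Suc (Suc (Suc n))) q
    = q ^ (c (k + n + 1) - 1) *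
      (q_continuant c (Suc k) (Suc n) q * q_continuant c k (Suc n) q
     - q_continuant c (Suc k) n q * q_continuant c k (Suc (Suc n)) q)"
    unfolding rec by (simp only: algebra_simps)
  also have "\<dots> = q ^ (c (k + n + 1) - 1) * q ^ (\<Sum>i<Suc n. c (k + i) - 1)"
    by (simp only: Suc.IH)
  also have "\<dots> = q ^ (\<Sum>i<Suc (Suc n). c (k + i) - 1)"
    by (simp add: power_add algebra_simps)
  finally show ?case .
qed

text \<open>
  The identities below are needed at a complex number \<open>q\<close>, where one can divide by every nonzero
  element, and at the formal variable, where one can divide by the series with nonzero constant term.
  The set \<open>U\<close> collects elements that permit division and contains all denominators that occur.
\<close>

locale q_fraction =
  fixes U :: "'a::{idom,inverse} set" and q :: 'a and c :: "nat \<Rightarrow> nat"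
  assumes divide_mult_U: "y \<in> U \<Longrightarrow> z / y * y = z"
    and mult_U: "y \<in> U \<Longrightarrow> z \<in> U \<Longrightarrow> y * z \<in> U"
    and zero_notin_U: "0 \<notin> U"
    and continuant_U: "1 \<le> k \<Longrightarrow> q_continuant c k n q \<in> U"
    and fraction_U: "1 \<le> k \<Longrightarrow> q_ncf c k n q \<in> U"
begin

lemma fraction_eq_continuant_quotient:
  assumes "1 \<le> k"
  shows "q_continuant c (Suc k) n q * q_ncf c k n q = q_continuant c k (Suc n) q"
  using assms
proof (induction n arbitrary: k)
  case (Suc n)
  define F where "F = q_ncf c (Suc k) n q"
  define u where "u = q ^ (c k - 1) / F"
  have "q_continuant c (Suc (Suc k)) n q * F = q_continuant c (Suc k) (Suc n) q"
    unfolding F_def by (rule Suc.IH) simp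
  moreover have "u * F = q ^ (c k - 1)"
    unfolding u_def F_def by (intro divide_mult_U fraction_U) simp
  ultimately have
    "u * q_continuant c (Suc k) (Suc n) q = q ^ (c k - 1) * q_continuant c (Suc (Suc k)) n q"
    by (metis mult.assoc mult.commute)
  hence "q_continuant c k (Suc (Suc n)) q = q_continuant c (Suc k) (Suc n) q * (q_int (c k) q - u)"
    unfolding q_continuant_left_rec by (simp only: algebra_simps)
  thus ?case by (simp add: u_def F_def)
qed simp

lemma partial_sum_eq_continuant_quotient:
  assumes "1 \<le> k"
  shows "(\<Sum>j<Suc n. q_term c k q j) * q_continuant c k (Suc n) q = q_continuant c (Suc k) n q"
proof (induction n)
  case 0
  show ?case
    using divide_mult_U[OF continuant_U[OF assms, of 1], of 1] by (simp add: q_term_def)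
next
  case (Suc n)
  define S where "S = (\<Sum>j<Suc n. q_term c k q j)"
  define t where "t = q_term c k q (Suc n)"
  define A where "A = q_continuant c k (Suc n) q"
  define A' where "A' = q_continuant c k (Suc (Suc n)) q"
  have AU: "A \<in> U" "A' \<in> U"
    unfolding A_def A'_def using assms by (simp_all only: continuant_U)
  have t: "t * (A * A') = q ^ (\<Sum>i<Suc n. c (k + i) - 1)"
    unfolding t_def q_term_def A_def[symmetric] A'_def[symmetric]
    by (rule divide_mult_U) (use AU in \<open>rule mult_U\<close>)
  have det: "q_continuant c (Suc k) (Suc n) q * A - q_continuant c (Suc k) n q * A'
      = q ^ (\<Sum>i<Suc n. c (k + i) - 1)"
    unfolding A_def A'_def by (rule q_continuant_determinant)
  have "(S + t) * A' * A = S * A * A' + t * (A * A')"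
    by (simp only: algebra_simps)
  also have "S * A = q_continuant c (Suc k) n q"
    unfolding S_def A_def by (rule Suc.IH)
  (* By the determinant identity, the new term is the difference of two consecutive quotients. *)
  also have "q_continuant c (Suc k) n q * A' + t * (A * A') = q_continuant c (Suc k) (Suc n) q * A"
    unfolding t det[symmetric] by simp
  finally have "(S + t) * A' = q_continuant c (Suc k) (Suc n) q"
    using AU zero_notin_U by auto
  thus ?case by (simp add: S_def t_def A'_def)
qed

lemma partial_sum_mult_fraction:
  assumes "1 \<le> k"
  shows "(\<Sum>j<Suc n. q_term c k q j) * q_ncf c k n q = 1"
proof -
  define S where "S = (\<Sum>j<Suc n. q_term c k q j)"
  have "S * q_ncf c k n q * q_continuant c (Suc k) n q = 1 * q_continuant c (Suc k) n q"
    using fraction_eq_continuant_quotient[OF assms, of n]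
      partial_sum_eq_continuant_quotient[OF assms, of n]
    unfolding S_def by (metis mult.assoc mult.commute mult.left_neutral)
  moreover have "q_continuant c (Suc k) n q \<noteq> 0"
    using continuant_U[of "Suc k" n] zero_notin_U by auto
  ultimately show ?thesis unfolding S_def by (metis mult_right_cancel)
qed

text \<open>
  Since the fraction that starts at the second digit is the reciprocal of a partial sum, the error of a
  truncation becomes an error of the shifted series. For \<open>n = 0\<close> the empty sum plays the role of the
  reciprocal of an empty fraction.
\<close>

lemma fraction_eq_digit_minus_partial_sum:
  assumes "1 \<le> k"
  shows "q_ncf c k n q = q_int (c k) q - q ^ (c k - 1) * (\<Sum>j<n. q_term c (Suc k) q j)"
proof (cases n)
  case (Suc m)
  define F where "F = q_ncf c (Suc k) m q"
  have F: "F \<in> U" unfolding F_def by (rule fraction_U) simp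
  have "q ^ (c k - 1) / F * F = q ^ (c k - 1) * (\<Sum>j<n. q_term c (Suc k) q j) * F"
    using partial_sum_mult_fraction[of "Suc k" m] divide_mult_U[OF F]
    by (simp add: F_def Suc mult.assoc del: sum.lessThan_Suc)
  hence "q ^ (c k - 1) / F = q ^ (c k - 1) * (\<Sum>j<n. q_term c (Suc k) q j)"
    using F zero_notin_U by auto
  thus ?thesis by (simp add: Suc F_def)
qed simp

end

section \<open>The identity of formal power series\<close>

lemma fps_tendsto_mult:
  fixes f g :: "'b \<Rightarrow> 'a::ring fps"
  assumes "(f \<longlongrightarrow> F) net" "(g \<longlongrightarrow> G) net"
  shows "((\<lambda>x. f x * g x) \<longlongrightarrow> F * G) net"
proof (rule tendsto_fpsI)
  fix n
  have "\<forall>\<^sub>F x in net. \<forall>i\<in>{..n}. f x $ i = F $ i" "\<forall>\<^sub>F x in net. \<forall>i\<in>{..n}. g x $ i = G $ i"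
    using assms by (simp_all add: eventually_ball_finite tendsto_fps_iff)
  thus "\<forall>\<^sub>F x in net. (f x * g x) $ n = (F * G) $ n"
    by eventually_elim (simp add: fps_mult_nth)
qed

text \<open>
  In the \<open>q\<close>-adic topology a series converges as soon as every coefficient is affected by finitely
  many terms only.
\<close>

lemma fps_summableI:
  fixes f :: "nat \<Rightarrow> 'a::ab_group_add fps"
  assumes "\<And>j n. n < j \<Longrightarrow> f j $ n = 0"
  shows "summable f"
proof -
  have "(\<lambda>N. \<Sum>j<N. f j) \<longlonglongrightarrow> Abs_fps (\<lambda>n. \<Sum>j\<le>n. f j $ n)"
  proof (rule tendsto_fpsI)
    fix n
    have "(\<Sum>j<N. f j) $ n = (\<Sum>j\<le>n. f j $ n)" if "N > n" for N
      unfolding fps_sum_nth using that assms by (intro sum.mono_neutral_right) auto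
    thus "\<forall>\<^sub>F N in sequentially. (\<Sum>j<N. f j) $ n = Abs_fps (\<lambda>n. \<Sum>j\<le>n. f j $ n) $ n"
      by (auto intro: eventually_mono[OF eventually_gt_at_top[of n]])
  qed
  thus ?thesis by (auto simp: summable_def sums_def)
qed

locale digit_sequence =
  fixes c :: "nat \<Rightarrow> nat"
  assumes digit_ge_2: "1 \<le> j \<Longrightarrow> 2 \<le> c j"
begin

lemma exponent_eq:
  assumes "1 \<le> k"
  shows "(\<Sum>i<n. c (k + i) - 1) = (\<Sum>i<n. c (k + i) - 2) + n"
proof -
  have "c (k + i) - 1 = (c (k + i) - 2) + 1" for i
    using digit_ge_2[of "k + i"] assms by linarith
  hence "(\<Sum>i<n. c (k + i) - 1) = (\<Sum>i<n. (c (k + i) - 2) + 1)"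
    by (intro sum.cong refl)
  thus ?thesis by (simp only: sum.distrib) simp
qed

lemma fps_q_int_nth_0:
  "1 \<le> k \<Longrightarrow> q_int (c k) (fps_X :: 'a::field fps) $ 0 = 1"
  using digit_ge_2[of k] by (simp add: q_int_def fps_divide_unit power_0_left)

lemma digit_not_le_1:
  "1 \<le> k \<Longrightarrow> \<not> c k \<le> Suc 0"
  using digit_ge_2[of k] by simp

lemma fps_continuant_nth_0:
  "1 \<le> k \<Longrightarrow> q_continuant c k n (fps_X :: 'a::field fps) $ 0 = 1"
  by (induction n rule: induct_nat_012) (simp_all add: fps_q_int_nth_0 digit_not_le_1)

lemma fps_fraction_nth_0:
  "1 \<le> k \<Longrightarrow> q_ncf c k n (fps_X :: 'a::field fps) $ 0 = 1"
  by (induction n arbitrary: k) (simp_all add: fps_q_int_nth_0 digit_not_le_1)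

sublocale fps: q_fraction "{f :: 'a::field fps. f $ 0 \<noteq> 0}" fps_X c
  by standard
    (auto simp: fps_divide_unit mult.assoc inverse_mult_eq_1 fps_continuant_nth_0 fps_fraction_nth_0)

lemma fps_summable_q_term:
  assumes "1 \<le> k"
  shows "summable (q_term c k (fps_X :: 'a::field fps))"
proof (rule fps_summableI)
  fix j n :: nat
  assume "n < j"
  moreover have "j \<le> (\<Sum>i<j. c (k + i) - 1)"
    using exponent_eq[OF assms, of j] by simp
  ultimately show "q_term c k (fps_X :: 'a fps) j $ n = 0"
    using assms by (simp add: q_term_def fps_divide_unit fps_continuant_nth_0 fps_X_power_mult_nth)
qed

text \<open>
  The product of a partial sum and the corresponding fraction is 1. Both factors converge
  coefficientwise, the fractions because of their expression by partial sums of the shifted series.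
\<close>

lemma fps_q_term_sums:
  "q_term c 1 (fps_X :: 'a::field fps) sums (1 / lim (\<lambda>N. q_ncf c 1 (N - 1) fps_X))"
proof -
  define V where "V k = (\<Sum>j. q_term c k (fps_X :: 'a fps) j)" for k
  define L where "L = q_int (c 1) fps_X - fps_X ^ (c 1 - 1) * V (Suc 1)"
  have V: "(\<lambda>n. \<Sum>j<n. q_term c k fps_X j) \<longlonglongrightarrow> V k" if "1 \<le> k" for k
    unfolding V_def by (rule summable_LIMSEQ[OF fps_summable_q_term[OF that]])
  have "(\<lambda>n. fps_X ^ (c 1 - 1) * (\<Sum>j<n. q_term c (Suc 1) (fps_X :: 'a fps) j))
          \<longlonglongrightarrow> fps_X ^ (c 1 - 1) * V (Suc 1)"
    by (intro fps_tendsto_mult V tendsto_const) simp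
  hence F: "(\<lambda>n. q_ncf c 1 n fps_X) \<longlonglongrightarrow> L"
    by (simp add: fps.fraction_eq_digit_minus_partial_sum L_def tendsto_fps_iff)
  hence "(\<lambda>N. q_ncf c 1 (N - 1) fps_X) \<longlonglongrightarrow> L"
    by (subst filterlim_sequentially_Suc[symmetric]) simp
  hence lim: "lim (\<lambda>N. q_ncf c 1 (N - 1) fps_X) = L"
    by (rule limI)
  have "(\<lambda>n. (\<Sum>j<Suc n. q_term c 1 fps_X j) * q_ncf c 1 n fps_X) \<longlonglongrightarrow> V 1 * L"
    by (intro fps_tendsto_mult F LIMSEQ_Suc[OF V]) simp
  hence "(\<lambda>n. 1) \<longlonglongrightarrow> V 1 * L"
    by (simp only: fps.partial_sum_mult_fraction order_refl)
  hence VL: "V 1 * L = 1"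
    by (rule LIMSEQ_unique[OF tendsto_const, symmetric])
  hence "fps_nth (V 1) 0 * fps_nth L 0 = 1" by (metis fps_mult_nth_0 fps_one_nth)
  hence "1 / L * L = 1" by (intro fps.divide_mult_U) auto
  with VL have "1 / L = V 1" by (metis mult_right_cancel mult_zero_right zero_neq_one)
  thus ?thesis
    unfolding lim V_def using summable_sums[OF fps_summable_q_term[of 1]] by simp
qed

end

section \<open>The region and the growth rate\<close>

text \<open>
  On the region this is a lower bound for the modulus of every \<open>q\<close>-integer \<open>[m]\<^sub>q\<close> with
  \<open>m \<ge> 2\<close>, hence for those that belong to the digits of a continued fraction.
\<close>

definition digit_bound :: "complex \<Rightarrow> real" where
  "digit_bound q = (1 - (norm q)\<^sup>2) / norm (1 - q)"

text \<open>
  The larger root of \<open>t\<^sup>2 - h t + |q| = 0\<close> with \<open>h = digit_bound q\<close>. It equals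
  \<open>\<surd>|q| / a(q)\<close>, but this form also makes sense at \<open>q = 0\<close>, where it is 1, and is visibly
  continuous.
\<close>

definition growth_rate :: "complex \<Rightarrow> real" where
  "growth_rate q = (digit_bound q + sqrt ((digit_bound q)\<^sup>2 - 4 * norm q)) / 2"

lemma norm_one_minus_sq: "(norm (1 - q))\<^sup>2 = 1 - 2 * Re q + (norm q)\<^sup>2"
  unfolding cmod_power2 by (simp add: power2_eq_square algebra_simps)

text \<open>
  Both sides say that \<open>r < 1\<close> and \<open>4 r s < (1 - r)\<^sup>2\<close>. On the left this is what remains after squaring, because
  \<open>(1 + 2 s)\<^sup>2 - 4 s (1 + s) = 1\<close>; on the right the difference of the two expressions is
  \<open>(1 - r)\<^sup>4 - (4 r s)\<^sup>2\<close>.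
\<close>

lemma radius_condition_iff:
  fixes r s :: real
  assumes "0 \<le> r" "0 \<le> s"
  shows "r < 1 + 2 * s - 2 * sqrt (s * (1 + s)) \<longleftrightarrow>
    r < 1 \<and> 4 * r * ((1 - r)\<^sup>2 + 4 * r * s\<^sup>2) < (1 - r\<^sup>2)\<^sup>2"
proof -
  have factor: "(1 - r\<^sup>2)\<^sup>2 - 4 * r * ((1 - r)\<^sup>2 + 4 * r * s\<^sup>2) = ((1 - r)\<^sup>2)\<^sup>2 - (4 * r * s)\<^sup>2"
    by (simp add: power2_eq_square algebra_simps)
  have "4 * r * ((1 - r)\<^sup>2 + 4 * r * s\<^sup>2) < (1 - r\<^sup>2)\<^sup>2 \<longleftrightarrow> (4 * r * s)\<^sup>2 < ((1 - r)\<^sup>2)\<^sup>2"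
    using factor by linarith
  also have "\<dots> \<longleftrightarrow> 4 * r * s < (1 - r)\<^sup>2"
    using assms by (metis mult_nonneg_nonneg power2_less_imp_less power_strict_mono pos2
        zero_le_numeral zero_le_power2)
  also have "\<dots> \<longleftrightarrow> 4 * (s * (1 + s)) < (1 + 2 * s - r)\<^sup>2"
    by (simp add: power2_eq_square algebra_simps)
  finally have iff: "4 * r * ((1 - r)\<^sup>2 + 4 * r * s\<^sup>2) < (1 - r\<^sup>2)\<^sup>2 \<longleftrightarrow>
    4 * (s * (1 + s)) < (1 + 2 * s - r)\<^sup>2" .
  have sqrt4: "2 * sqrt (s * (1 + s)) = sqrt (4 * (s * (1 + s)))"
    by (simp add: real_sqrt_mult)
  have "s \<le> sqrt (s * (1 + s))"
    using assms by (intro real_le_rsqrt) (simp add: power2_eq_square algebra_simps)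
  hence "r < 1" if "r < 1 + 2 * s - 2 * sqrt (s * (1 + s))"
    using that by linarith
  moreover have "2 * sqrt (s * (1 + s)) < 1 + 2 * s - r \<longleftrightarrow> 4 * (s * (1 + s)) < (1 + 2 * s - r)\<^sup>2"
    if "r < 1"
  proof -
    have "sqrt (4 * (s * (1 + s))) < sqrt ((1 + 2 * s - r)\<^sup>2) \<longleftrightarrow>
        4 * (s * (1 + s)) < (1 + 2 * s - r)\<^sup>2"
      by (rule real_sqrt_less_iff)
    thus ?thesis unfolding sqrt4 using that assms by simp
  qed
  ultimately show ?thesis unfolding iff by linarith
qed

text \<open>
  With \<open>s = sin (\<theta> / 2)\<close> one has \<open>|1 - q|\<^sup>2 = (1 - r)\<^sup>2 + 4 r s\<^sup>2\<close>, which removes the argument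
  of \<open>q\<close> from the description of the region. The condition is that the quadratic equation for the
  growth rate has positive discriminant.
\<close>

lemma region_D_eq:
  "region_D = {q. norm q < 1 \<and> 4 * norm q * (norm (1 - q))\<^sup>2 < (1 - (norm q)\<^sup>2)\<^sup>2}"
proof -
  have norm_rcis: "(norm (1 - rcis r \<theta>))\<^sup>2 = (1 - r)\<^sup>2 + 4 * r * (sin (\<theta> / 2))\<^sup>2"
    if "0 \<le> r" for r \<theta>
  proof -
    have cos_eq: "cos \<theta> = 1 - 2 * (sin (\<theta> / 2))\<^sup>2"
      using cos_double_sin[of "\<theta> / 2"] by simp
    thus ?thesis
      unfolding norm_one_minus_sq using that by (simp add: cos_eq power2_eq_square algebra_simps)
  qed
  have iff: "r < 1 + 2 * sin (\<theta> / 2) - 2 * sqrt (sin (\<theta> / 2) * (1 + sin (\<theta> / 2))) \<longleftrightarrow>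
      norm (rcis r \<theta>) < 1 \<and>
      4 * norm (rcis r \<theta>) * (norm (1 - rcis r \<theta>))\<^sup>2 < (1 - (norm (rcis r \<theta>))\<^sup>2)\<^sup>2"
    if "0 \<le> r" "0 \<le> \<theta>" "\<theta> \<le> 2 * pi" for r \<theta>
    using radius_condition_iff[of r "sin (\<theta> / 2)"] that
    by (simp add: norm_rcis sin_ge_zero)
  show ?thesis
  proof (intro equalityI subsetI)
    fix q assume "q \<in> region_D"
    thus "q \<in> {q. norm q < 1 \<and> 4 * norm q * (norm (1 - q))\<^sup>2 < (1 - (norm q)\<^sup>2)\<^sup>2}"
      unfolding region_D_def using iff by blast
  next
    fix q :: complex
    assume q: "q \<in> {q. norm q < 1 \<and> 4 * norm q * (norm (1 - q))\<^sup>2 < (1 - (norm q)\<^sup>2)\<^sup>2}"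
    have polar: "q = rcis (norm q) (Arg2pi q)" "0 \<le> Arg2pi q" "Arg2pi q \<le> 2 * pi"
      using Arg2pi[of q] by (auto simp: is_Arg_def rcis_def cis_conv_exp)
    thus "q \<in> region_D"
      unfolding region_D_def using q iff[of "norm q" "Arg2pi q"] by fastforce
  qed
qed

lemma open_region_D: "open region_D"
  unfolding region_D_eq by (intro open_Collect_conj open_Collect_less continuous_intros)

lemma real_interval_subset_region_D:
  "complex_of_real ` {-3 + 2 * sqrt 2 <..< 1} \<subseteq> region_D"
proof safe
  fix t :: real
  assume t: "t \<in> {-3 + 2 * sqrt 2 <..< 1}"
  show "complex_of_real t \<in> region_D"
  proof (cases "t \<ge> 0")
    case True
    thus ?thesis
      using t unfolding region_D_def
      by (intro CollectI exI[of _ t] exI[of _ 0]) (auto simp: rcis_def)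
  next
    case False
    thus ?thesis
      using t unfolding region_D_def
      by (intro CollectI exI[of _ "-t"] exI[of _ pi]) (auto simp: rcis_def cis_pi)
  qed
qed

context
  fixes q assumes q: "q \<in> region_D"
begin

lemma norm_lt_1: "norm q < 1"
  using q by (simp add: region_D_eq)

lemma one_minus_pos: "0 < norm (1 - q)"
  using norm_lt_1 by auto

lemma digit_bound_pos: "0 < digit_bound q"
  unfolding digit_bound_def using norm_lt_1 one_minus_pos
  by (intro divide_pos_pos) (simp_all add: power_less_one_iff abs_square_less_1)

lemma discriminant_pos: "0 < (digit_bound q)\<^sup>2 - 4 * norm q"
  using q one_minus_pos
  by (simp add: region_D_eq digit_bound_def power_divide field_simps)

lemma growth_rate_root: "(growth_rate q)\<^sup>2 + norm q = digit_bound q * growth_rate q"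
proof -
  have "(sqrt ((digit_bound q)\<^sup>2 - 4 * norm q))\<^sup>2 = (digit_bound q)\<^sup>2 - 4 * norm q"
    using discriminant_pos by simp
  thus ?thesis
    by (simp add: growth_rate_def power2_eq_square field_simps)
qed

lemma growth_rate_pos: "0 < growth_rate q"
  unfolding growth_rate_def using digit_bound_pos discriminant_pos
  by (intro divide_pos_pos add_pos_pos) auto

lemma norm_lt_growth_rate_sq: "norm q < (growth_rate q)\<^sup>2"
proof -
  have "digit_bound q < 2 * growth_rate q"
    unfolding growth_rate_def using discriminant_pos by simp
  hence "digit_bound q * growth_rate q < 2 * growth_rate q * growth_rate q"
    using growth_rate_pos by simp
  thus ?thesis
    using growth_rate_root by (simp add: power2_eq_square)
qed

lemma digit_bound_eq: "digit_bound q = growth_rate q + norm q / growth_rate q"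
  using growth_rate_root growth_rate_pos by (simp add: field_simps power2_eq_square)

text \<open>
  The left-hand side of the equation for \<open>a\<close> equals \<open>h / \<surd>|q|\<close> with \<open>h = digit_bound q\<close>, and
  \<open>h = g + |q| / g\<close> for the growth rate \<open>g\<close>. Uniqueness holds because \<open>a + 1 / a = p + 1 / p\<close>
  forces \<open>a = p\<close> or \<open>a p = 1\<close>.
\<close>

lemma a_fun_eq: "a_fun q = sqrt (norm q) / growth_rate q"
proof (cases "q = 0")
  case False
  define r where "r = norm q"
  define p where "p = sqrt r / growth_rate q"
  define P where "P a \<longleftrightarrow> 0 < a \<and> a < 1 \<and>
    (1 / r - r) / sqrt (r + 1 / r - 2 * cos (Arg q)) = a + 1 / a" for a
  have r: "0 < r" using False by (simp add: r_def)
  have "Re q = r * cos (Arg q)"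
    unfolding r_def by (metis Re_rcis rcis_cmod_Arg)
  hence "r + 1 / r - 2 * cos (Arg q) = (norm (1 - q))\<^sup>2 / r"
    unfolding norm_one_minus_sq r_def[symmetric]
    using r by (simp add: field_simps power2_eq_square)
  hence sqrt_eq: "sqrt (r + 1 / r - 2 * cos (Arg q)) = norm (1 - q) / sqrt r"
    by (simp add: real_sqrt_divide)
  have "(1 / r - r) / sqrt (r + 1 / r - 2 * cos (Arg q)) = digit_bound q * (sqrt r / r)"
  proof -
    have "1 / r - r = (1 - r\<^sup>2) / r"
      using r by (simp add: power2_eq_square diff_divide_distrib)
    thus ?thesis
      unfolding sqrt_eq digit_bound_def r_def[symmetric] by (simp only: divide_divide_eq_right) simp
  qed
  also have "\<dots> = digit_bound q / sqrt r"
  proof -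
    have "sqrt r / r = 1 / sqrt r"
      using r by (simp add: divide_eq_eq real_div_sqrt)
    thus ?thesis by simp
  qed
  also have "\<dots> = p + 1 / p"
  proof -
    have "r / sqrt r = sqrt r"
      using r by (simp add: real_div_sqrt)
    hence "norm q / growth_rate q / sqrt r = p"
      unfolding p_def r_def[symmetric] by (metis divide_divide_eq_left mult.commute)
    thus ?thesis
      unfolding digit_bound_eq add_divide_distrib by (simp add: p_def)
  qed
  finally have lhs: "(1 / r - r) / sqrt (r + 1 / r - 2 * cos (Arg q)) = p + 1 / p" .
  have p: "0 < p" "p < 1"
    using r growth_rate_pos norm_lt_growth_rate_sq
    by (simp_all add: p_def real_less_lsqrt flip: r_def)
  have "(THE a. P a) = p"
  proof (rule the_equality)
    show "P p" using p lhs by (simp add: P_def)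
  next
    fix a assume "P a"
    hence a: "0 < a" "a < 1" "p + 1 / p = a + 1 / a"
      by (simp_all add: P_def lhs)
    have "(a - p) * (1 - a * p) = a * p * (p + 1 / p - (a + 1 / a))"
      using a(1) p(1) by (simp add: field_simps)
    also have "\<dots> = 0" using a(3) by simp
    finally have "a = p \<or> a * p = 1" by auto
    moreover have "a * p < 1 * 1" using a(1,2) p by (intro mult_strict_mono) auto
    ultimately show "a = p" by auto
  qed
  thus ?thesis
    using False by (simp add: a_fun_def P_def p_def r_def)
qed (simp add: a_fun_def)

lemma a_fun_nonneg: "0 \<le> a_fun q"
  unfolding a_fun_eq using growth_rate_pos by simp

lemma a_fun_sq: "(a_fun q)\<^sup>2 = norm q / (growth_rate q)\<^sup>2"
  by (simp add: a_fun_eq power_divide)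

lemma a_fun_sq_lt_1: "(a_fun q)\<^sup>2 < 1"
  unfolding a_fun_sq using norm_lt_growth_rate_sq growth_rate_pos by simp

lemma a_ratio_eq: "a_ratio q = 1 / growth_rate q"
proof (cases "q = 0")
  case False
  thus ?thesis
    by (simp add: a_ratio_def a_fun_eq powr_minus powr_half_sqrt field_simps)
qed (simp add: a_ratio_def growth_rate_def digit_bound_def)

lemma norm_q_int_ge:
  assumes "2 \<le> m"
  shows "digit_bound q \<le> norm (q_int m q)"
proof -
  have "norm q ^ m \<le> (norm q)\<^sup>2"
    using norm_lt_1 assms by (intro power_decreasing) auto
  moreover have "1 - norm q ^ m \<le> norm (1 - q ^ m)"
    using norm_triangle_ineq2[of 1 "q ^ m"] by (simp add: norm_power)
  ultimately show ?thesis
    by (simp add: digit_bound_def q_int_def norm_divide divide_right_mono)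
qed

text \<open>
  The central estimate: the growth rate \<open>g\<close> is a fixed point of \<open>t \<mapsto> h - |q| / t\<close>, so a quotient
  \<open>u / v\<close> of modulus at least \<open>g\<close> is followed by a quotient of modulus at least \<open>g\<close>. It
  applies to the recursion of the continuants and, with \<open>u = 1\<close>, to that of the fractions.
\<close>

lemma recursion_step_norm_ge:
  assumes m: "2 \<le> m" and e: "2 \<le> e" and uv: "growth_rate q * norm v \<le> norm u"
  shows "growth_rate q * norm u \<le> norm (q_int m q * u - q ^ (e - 1) * v)"
proof -
  have "norm q ^ (e - 1) \<le> norm q ^ 1"
    using e norm_lt_1 by (intro power_decreasing) auto
  hence "norm (q ^ (e - 1) * v) \<le> norm q * norm v"
    by (simp add: norm_mult norm_power mult_right_mono)
  also have "\<dots> \<le> norm q * (norm u / growth_rate q)"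
    using uv growth_rate_pos by (intro mult_left_mono) (simp_all add: field_simps)
  finally have "norm (q ^ (e - 1) * v) \<le> norm q / growth_rate q * norm u"
    by simp
  moreover have "digit_bound q * norm u \<le> norm (q_int m q * u)"
    using norm_q_int_ge[OF m] by (simp add: norm_mult mult_right_mono)
  ultimately have "digit_bound q * norm u - norm q / growth_rate q * norm u
      \<le> norm (q_int m q * u - q ^ (e - 1) * v)"
    using norm_triangle_ineq2[of "q_int m q * u" "q ^ (e - 1) * v"] by linarith
  thus ?thesis
    by (simp add: digit_bound_eq algebra_simps)
qed

end

lemma continuous_on_growth_rate: "continuous_on region_D growth_rate"
  unfolding growth_rate_def digit_bound_def
  using one_minus_pos by (intro continuous_intros) fastforce+

section \<open>Convergence and the error bounds\<close>

context digit_sequence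
begin

context
  fixes q assumes q: "q \<in> region_D"
begin

lemma continuant_growth:
  assumes "1 \<le> k"
  shows "growth_rate q * norm (q_continuant c k n q) \<le> norm (q_continuant c k (Suc n) q)"
proof (induction n)
  case 0
  have "growth_rate q \<le> digit_bound q"
    using digit_bound_eq[OF q] growth_rate_pos[OF q] by simp
  also have "\<dots> \<le> norm (q_int (c k) q)"
    using norm_q_int_ge[OF q digit_ge_2[OF assms]] .
  finally show ?case by simp
next
  case (Suc n)
  show ?case
    unfolding q_continuant.simps(3)[of c k n q]
    by (intro recursion_step_norm_ge[OF q] digit_ge_2 Suc.IH) (use assms in auto)
qed

lemma continuant_norm_ge:
  assumes "1 \<le> k"
  shows "growth_rate q ^ n \<le> norm (q_continuant c k n q)"
proof (induction n)
  case (Suc n)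
  have "growth_rate q ^ Suc n \<le> growth_rate q * norm (q_continuant c k n q)"
    using Suc.IH growth_rate_pos[OF q] by simp
  also note continuant_growth[OF assms]
  finally show ?case .
qed simp

lemma continuant_nonzero: "1 \<le> k \<Longrightarrow> q_continuant c k n q \<noteq> 0"
  using continuant_norm_ge[of k n] zero_less_power[OF growth_rate_pos[OF q], of n] by auto

lemma fraction_norm_ge:
  assumes "1 \<le> k"
  shows "growth_rate q \<le> norm (q_ncf c k n q)"
  using assms
proof (induction n arbitrary: k)
  case 0
  thus ?case using continuant_growth[of k 0] by simp
next
  case (Suc n)
  have "growth_rate q * norm (1 / q_ncf c (Suc k) n q) \<le> norm (1 :: complex)"
    using Suc.IH[of "Suc k"] growth_rate_pos[OF q] by (simp add: norm_divide divide_simps)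
  from recursion_step_norm_ge[OF q digit_ge_2[OF Suc.prems] digit_ge_2[OF Suc.prems] this]
  show ?case by simp
qed

lemma fraction_nonzero: "1 \<le> k \<Longrightarrow> q_ncf c k n q \<noteq> 0"
  using fraction_norm_ge[of k n] growth_rate_pos[OF q] by auto

text \<open>
  Since every digit contributes \<open>(c - 2) + 1\<close> to the exponent, the denominators are compensated by
  \<open>(|q| / g\<^sup>2)\<^sup>j = a\<^bsup>2j\<^esup>\<close>, where \<open>g\<close> is the growth rate.
\<close>

lemma norm_q_term_le:
  assumes "1 \<le> k"
  shows "norm (q_term c k q j)
    \<le> a_ratio q * norm q ^ (\<Sum>i<j. c (k + i) - 2) * a_fun q ^ (2 * j)"
proof -
  have "growth_rate q ^ j * growth_rate q ^ Suc j
      \<le> norm (q_continuant c k j q) * norm (q_continuant c k (Suc j) q)"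
    using growth_rate_pos[OF q] by (intro mult_mono continuant_norm_ge assms) auto
  hence "norm (q_term c k q j)
      \<le> norm q ^ ((\<Sum>i<j. c (k + i) - 2) + j) / (growth_rate q ^ j * growth_rate q ^ Suc j)"
    unfolding q_term_def exponent_eq[OF assms] norm_divide norm_mult norm_power
    using growth_rate_pos[OF q]
    by (intro divide_left_mono)
      (auto intro!: mult_pos_pos continuant_nonzero assms simp del: q_continuant.simps)
  also have "\<dots> = a_ratio q * norm q ^ (\<Sum>i<j. c (k + i) - 2) * ((a_fun q)\<^sup>2) ^ j"
    using growth_rate_pos[OF q]
    by (simp add: a_ratio_eq[OF q] a_fun_sq[OF q] power_add power_divide flip: power_mult)
       (simp add: mult_2 power_add)
  finally show ?thesis by (simp add: power_mult)
qed

lemma norm_q_term_le_geometric: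
  assumes "1 \<le> k"
  shows "norm (q_term c k q j) \<le> a_ratio q * ((a_fun q)\<^sup>2) ^ j"
proof -
  have "norm q ^ (\<Sum>i<j. c (k + i) - 2) \<le> 1"
    using norm_lt_1[OF q] by (intro power_le_one) auto
  hence "a_ratio q * norm q ^ (\<Sum>i<j. c (k + i) - 2) * a_fun q ^ (2 * j)
      \<le> a_ratio q * 1 * a_fun q ^ (2 * j)"
    using growth_rate_pos[OF q] a_fun_nonneg[OF q]
    by (intro mult_right_mono mult_left_mono) (auto simp: a_ratio_eq[OF q])
  thus ?thesis
    using norm_q_term_le[OF assms, of j] by (simp add: power_mult)
qed

lemma summable_norm_q_term:
  assumes "1 \<le> k"
  shows "summable (\<lambda>j. norm (q_term c k q j))"
proof (rule summable_comparison_test')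
  show "summable (\<lambda>j. a_ratio q * ((a_fun q)\<^sup>2) ^ j)"
    using a_fun_sq_lt_1[OF q] by (intro summable_mult summable_geometric) simp
  show "norm (norm (q_term c k q j)) \<le> a_ratio q * ((a_fun q)\<^sup>2) ^ j" for j
    using norm_q_term_le_geometric[OF assms] by simp
qed

lemma tail_bound:
  assumes "1 \<le> k"
  shows "norm ((\<Sum>j<n. q_term c k q j) - (\<Sum>j. q_term c k q j))
    \<le> a_ratio q / (1 - (a_fun q)\<^sup>2) * norm q ^ (\<Sum>i<n. c (k + i) - 2) * a_fun q ^ (2 * n)"
proof -
  define B where "B = a_ratio q * norm q ^ (\<Sum>i<n. c (k + i) - 2) * a_fun q ^ (2 * n)"
  have bound: "norm (q_term c k q (j + n)) \<le> B * ((a_fun q)\<^sup>2) ^ j" for j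
  proof -
    have "norm q ^ (\<Sum>i<j + n. c (k + i) - 2) \<le> norm q ^ (\<Sum>i<n. c (k + i) - 2)"
      using norm_lt_1[OF q] by (intro power_decreasing sum_mono2) auto
    hence "a_ratio q * norm q ^ (\<Sum>i<j + n. c (k + i) - 2) * a_fun q ^ (2 * (j + n))
        \<le> a_ratio q * norm q ^ (\<Sum>i<n. c (k + i) - 2) * a_fun q ^ (2 * (j + n))"
      using growth_rate_pos[OF q] a_fun_nonneg[OF q]
      by (intro mult_right_mono mult_left_mono) (auto simp: a_ratio_eq[OF q])
    thus ?thesis
      using norm_q_term_le[OF assms, of "j + n"]
      by (simp add: B_def power_mult[symmetric] power_add algebra_simps)
  qed
  have geo: "(\<lambda>j. B * ((a_fun q)\<^sup>2) ^ j) sums (B * (1 / (1 - (a_fun q)\<^sup>2)))"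
    using a_fun_sq_lt_1[OF q] by (intro sums_mult geometric_sums) simp
  have "(\<Sum>j. q_term c k q j) = (\<Sum>j. q_term c k q (j + n)) + (\<Sum>j<n. q_term c k q j)"
    by (intro suminf_split_initial_segment summable_norm_cancel[OF summable_norm_q_term] assms)
  hence "norm ((\<Sum>j<n. q_term c k q j) - (\<Sum>j. q_term c k q j)) = norm (\<Sum>j. q_term c k q (j + n))"
    by simp
  also have "\<dots> \<le> B * (1 / (1 - (a_fun q)\<^sup>2))"
    using norm_suminf_le[OF bound sums_summable[OF geo]] sums_unique[OF geo] by simp
  finally show ?thesis by (simp add: B_def)
qed

interpretation q_fraction "- {0}" q c
  by standard (simp_all add: continuant_nonzero fraction_nonzero)

lemma inverse_fraction_eq_partial_sum:
  "1 \<le> k \<Longrightarrow> 1 / q_ncf c k n q = (\<Sum>j<Suc n. q_term c k q j)"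
  using partial_sum_mult_fraction[of k n] fraction_nonzero[of k n]
  by (simp add: field_simps del: sum.lessThan_Suc)

text \<open>
  The continued fraction recursion survives in the limit. As the product is 1, it shows at once that
  the series has a nonzero sum.
\<close>

lemma infinite_fraction_rec:
  assumes "1 \<le> k"
  shows "(\<Sum>j. q_term c k q j) * (q_int (c k) q - q ^ (c k - 1) * (\<Sum>j. q_term c (Suc k) q j)) = 1"
proof -
  have lim: "(\<lambda>n. \<Sum>j<n. q_term c k q j) \<longlonglongrightarrow> (\<Sum>j. q_term c k q j)" if "1 \<le> k" for k
    by (intro summable_LIMSEQ summable_norm_cancel[OF summable_norm_q_term] that)
  have "(\<lambda>n. (\<Sum>j<Suc n. q_term c k q j) *
        (q_int (c k) q - q ^ (c k - 1) * (\<Sum>j<n. q_term c (Suc k) q j)))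
      \<longlonglongrightarrow> (\<Sum>j. q_term c k q j) * (q_int (c k) q - q ^ (c k - 1) * (\<Sum>j. q_term c (Suc k) q j))"
    by (intro tendsto_intros LIMSEQ_Suc[OF lim] lim assms) simp
  moreover have "(\<Sum>j<Suc n. q_term c k q j) *
        (q_int (c k) q - q ^ (c k - 1) * (\<Sum>j<n. q_term c (Suc k) q j)) = 1" for n
    using partial_sum_mult_fraction[OF assms, of n] fraction_eq_digit_minus_partial_sum[OF assms, of n]
    by metis
  ultimately show ?thesis
    by (simp add: LIMSEQ_const_iff del: sum.lessThan_Suc)
qed

lemma q_series_nonzero: "1 \<le> k \<Longrightarrow> (\<Sum>j. q_term c k q j) \<noteq> 0"
  using infinite_fraction_rec[of k] by auto

text \<open>
  The error is \<open>q\<^bsup>c-1\<^esup>\<close> times a tail of the shifted series, where \<open>c\<close> is the first digit.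
  The estimate \<open>|q|\<^bsup>c-1\<^esup> \<le> |q|\<^bsup>c-2\<^esup>\<close> brings it into the form of the first error bound.
\<close>

lemma fraction_error_bound:
  assumes "1 \<le> k"
  shows "norm (q_ncf c k n q - 1 / (\<Sum>j. q_term c k q j))
    \<le> a_ratio q / (1 - (a_fun q)\<^sup>2) * norm q ^ (\<Sum>i<Suc n. c (k + i) - 2) * a_fun q ^ (2 * n)"
proof -
  define E where "E = (\<Sum>j<n. q_term c (Suc k) q j) - (\<Sum>j. q_term c (Suc k) q j)"
  define s where "s = (\<Sum>i<n. c (Suc k + i) - 2)"
  define M where "M = a_ratio q / (1 - (a_fun q)\<^sup>2)"
  have M: "0 \<le> M"
    unfolding M_def using a_fun_sq_lt_1[OF q] growth_rate_pos[OF q] by (simp add: a_ratio_eq[OF q])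
  have "1 / (\<Sum>j. q_term c k q j) = q_int (c k) q - q ^ (c k - 1) * (\<Sum>j. q_term c (Suc k) q j)"
    using infinite_fraction_rec[OF assms] q_series_nonzero[OF assms] by (simp add: field_simps)
  hence "q_ncf c k n q - 1 / (\<Sum>j. q_term c k q j) = - (q ^ (c k - 1) * E)"
    unfolding fraction_eq_digit_minus_partial_sum[OF assms] E_def by (simp add: algebra_simps)
  hence "norm (q_ncf c k n q - 1 / (\<Sum>j. q_term c k q j)) = norm q ^ (c k - 1) * norm E"
    by (simp add: norm_mult norm_power)
  also have "\<dots> \<le> norm q ^ (c k - 2) * (M * norm q ^ s * a_fun q ^ (2 * n))"
    using norm_lt_1[OF q] tail_bound[of "Suc k" n] unfolding E_def M_def s_def
    by (intro mult_mono power_decreasing) auto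
  also have "\<dots> = M * norm q ^ (c k - 2 + s) * a_fun q ^ (2 * n)"
    by (simp add: power_add)
  also have "c k - 2 + s = (\<Sum>i<Suc n. c (k + i) - 2)"
    unfolding s_def by (simp add: sum.lessThan_Suc_shift del: sum.lessThan_Suc)
  finally show ?thesis by (simp add: M_def)
qed

end

lemma uniform_limit_q_term:
  assumes "1 \<le> k" "compact K" "K \<subseteq> region_D"
  shows "uniform_limit K (\<lambda>n q. \<Sum>j<n. q_term c k q j) (\<lambda>q. \<Sum>j. q_term c k q j) sequentially"
proof (cases "K = {}")
  case False
  (* By compactness one geometric series dominates on all of K; its coefficient and its ratio are the
     maxima of two continuous functions and may be attained at different points u and v. *)
  have cont: "continuous_on K growth_rate"
    using continuous_on_growth_rate assms(3) by (rule continuous_on_subset)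
  have "continuous_on K (\<lambda>q. 1 / growth_rate q)"
    using growth_rate_pos assms(3) by (intro continuous_intros cont) fastforce
  from continuous_attains_sup[OF assms(2) False this] obtain u
    where u: "u \<in> K" "\<And>q. q \<in> K \<Longrightarrow> 1 / growth_rate q \<le> 1 / growth_rate u"
    by blast
  have "continuous_on K (\<lambda>q. norm q / (growth_rate q)\<^sup>2)"
    using growth_rate_pos assms(3) by (intro continuous_intros cont) fastforce
  from continuous_attains_sup[OF assms(2) False this] obtain v
    where v: "v \<in> K" "\<And>q. q \<in> K \<Longrightarrow> norm q / (growth_rate q)\<^sup>2 \<le> norm v / (growth_rate v)\<^sup>2"
    by blast
  show ?thesis
  proof (rule Weierstrass_m_test)
    fix j q assume "q \<in> K"
    hence q: "q \<in> region_D" using assms(3) by auto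
    have uv: "u \<in> region_D" "v \<in> region_D" using u v assms(3) by auto
    have "norm (q_term c k q j) \<le> a_ratio q * ((a_fun q)\<^sup>2) ^ j"
      by (rule norm_q_term_le_geometric[OF q assms(1)])
    also have "\<dots> \<le> a_ratio u * ((a_fun v)\<^sup>2) ^ j"
      unfolding a_ratio_eq[OF q] a_ratio_eq[OF uv(1)] a_fun_sq[OF q] a_fun_sq[OF uv(2)]
      using u(2)[OF \<open>q \<in> K\<close>] v(2)[OF \<open>q \<in> K\<close>] growth_rate_pos[OF uv(1)]
      by (intro mult_mono power_mono) auto
    finally show "norm (q_term c k q j) \<le> a_ratio u * ((a_fun v)\<^sup>2) ^ j" .
  next
    show "summable (\<lambda>j. a_ratio u * ((a_fun v)\<^sup>2) ^ j)"
      using a_fun_sq_lt_1[of v] v(1) assms(3) by (intro summable_mult summable_geometric) auto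
  qed
qed simp

lemma holomorphic_continuant: "(\<lambda>q. q_continuant c k n q) holomorphic_on region_D"
proof -
  have q_int: "(\<lambda>q. q_int m q) holomorphic_on region_D" for m
    unfolding q_int_def using one_minus_pos by (intro holomorphic_intros) fastforce
  show ?thesis
    by (induction n rule: induct_nat_012; simp only: q_continuant.simps)
      (intro holomorphic_intros q_int; assumption)+
qed

lemma holomorphic_q_series:
  assumes "1 \<le> k"
  shows "(\<lambda>q. \<Sum>j. q_term c k q j) holomorphic_on region_D"
proof (rule holomorphic_uniform_sequence[OF open_region_D])
  show "(\<lambda>q. \<Sum>j<n. q_term c k q j) holomorphic_on region_D" for n
    unfolding q_term_def
    by (intro holomorphic_intros holomorphic_continuant) (use continuant_nonzero assms in simp)
  fix z assume "z \<in> region_D"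
  then obtain d where "0 < d" "cball z d \<subseteq> region_D"
    using open_region_D open_contains_cball by blast
  thus "\<exists>d>0. cball z d \<subseteq> region_D \<and> uniform_limit (cball z d)
      (\<lambda>n q. \<Sum>j<n. q_term c k q j) (\<lambda>q. \<Sum>j. q_term c k q j) sequentially"
    using uniform_limit_q_term[OF assms compact_cball] by blast
qed

end

theorem theorem4p1:
  fixes x :: real
  assumes "x \<ge> 1"
  shows
    "psi_term x (fps_X :: rat fps) sums (1 / q_real_fps x) \<and>
     (\<forall>q\<in>region_D. \<forall>j. q_num x j q \<noteq> 0) \<and>
     (\<forall>q\<in>region_D. \<forall>N\<ge>1. q_real_trunc x N q \<noteq> 0) \<and>
     (\<forall>q\<in>region_D. summable (\<lambda>j. norm (psi_term x q j))) \<and>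
     (\<forall>K. compact K \<and> K \<subseteq> region_D \<longrightarrow>
        uniform_limit K (\<lambda>n q. \<Sum>j<n. psi_term x q j) (psi x) sequentially) \<and>
     psi x holomorphic_on region_D \<and>
     (\<forall>q\<in>region_D. psi x q \<noteq> 0) \<and>
     psi x analytic_on (complex_of_real ` {-3 + 2 * sqrt 2 <..< 1}) \<and>
     (\<forall>q\<in>region_D. \<forall>N.
        norm ((if N = 0 then 0 else 1 / q_real_trunc x N q) - 1 / q_real x q)
          \<le> a_ratio q / (1 - (a_fun q)\<^sup>2)
             * norm q ^ (\<Sum>i = 1..N. ncf_digits x i - 2) * a_fun q ^ (2 * N)) \<and>
     (\<forall>q\<in>region_D. \<forall>N\<ge>1.
        norm (q_real_trunc x N q - q_real x q)
          \<le> a_ratio q / (1 - (a_fun q)\<^sup>2)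
             * norm q ^ (\<Sum>i = 1..N. ncf_digits x i - 2) * a_fun q ^ (2 * N - 2))"
proof -
  define c where "c = ncf_digits x"
  have "ncf_expansion c x"
    using theI'[OF ncf_digits_unique_existence[OF assms]] by (simp add: c_def ncf_digits_def)
  then interpret digit_sequence c
    by unfold_locales (simp add: ncf_expansion_def)
  have exponent: "(\<Sum>i = 1..N. c i - 2) = (\<Sum>i<N. c (1 + i) - 2)" for N
    by (simp add: sum.atLeast1_atMost_eq)
  have psi: "psi x = (\<lambda>q. \<Sum>j. q_term c 1 q j)"
    by (simp add: fun_eq_iff psi_def psi_term_eq_q_term c_def)
  have trunc: "q_real_trunc x N q = q_ncf c 1 (N - 1) q" for N and q :: complex
    by (simp add: q_real_trunc_def c_def)
  have hol: "psi x holomorphic_on region_D"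
    unfolding psi by (rule holomorphic_q_series) simp
  have fps_sums: "psi_term x (fps_X :: rat fps) sums (1 / q_real_fps x)"
    unfolding psi_term_eq_q_term q_real_fps_def q_real_trunc_def
    using fps_q_term_sums by (simp add: c_def)
  have num: "q_num x j q \<noteq> 0" if "q \<in> region_D" for q j
    unfolding q_num_eq_continuant using continuant_nonzero[OF that] by (simp add: c_def)
  have trunc_nonzero: "q_real_trunc x N q \<noteq> 0" if "q \<in> region_D" for q N
    unfolding trunc using fraction_nonzero[OF that] by simp
  have summable: "summable (\<lambda>j. norm (psi_term x q j))" if "q \<in> region_D" for q
    unfolding psi_term_eq_q_term using summable_norm_q_term[OF that, of 1] by (simp add: c_def)
  have uniform: "uniform_limit K (\<lambda>n q. \<Sum>j<n. psi_term x q j) (psi x) sequentially"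
    if "compact K" "K \<subseteq> region_D" for K
    unfolding psi_term_eq_q_term psi c_def[symmetric]
    using that by (intro uniform_limit_q_term) auto
  have psi_nonzero: "psi x q \<noteq> 0" if "q \<in> region_D" for q
    unfolding psi using q_series_nonzero[OF that] by simp
  have analytic: "psi x analytic_on (complex_of_real ` {-3 + 2 * sqrt 2 <..< 1})"
    using hol analytic_on_open[OF open_region_D] analytic_on_subset real_interval_subset_region_D
    by blast
  have inverse_error: "norm ((if N = 0 then 0 else 1 / q_real_trunc x N q) - 1 / q_real x q)
      \<le> a_ratio q / (1 - (a_fun q)\<^sup>2)
        * norm q ^ (\<Sum>i = 1..N. c i - 2) * a_fun q ^ (2 * N)" if "q \<in> region_D" for q N
  proof -
    have "(if N = 0 then 0 else 1 / q_real_trunc x N q) = (\<Sum>j<N. q_term c 1 q j)"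
      using inverse_fraction_eq_partial_sum[OF that, of 1 "N - 1"]
      by (simp add: trunc del: sum.lessThan_Suc)
    thus ?thesis
      unfolding exponent q_real_def psi using tail_bound[OF that, of 1 N] by simp
  qed
  have error: "norm (q_real_trunc x N q - q_real x q)
      \<le> a_ratio q / (1 - (a_fun q)\<^sup>2)
        * norm q ^ (\<Sum>i = 1..N. c i - 2) * a_fun q ^ (2 * N - 2)" if "q \<in> region_D" "N \<ge> 1" for q N
    unfolding exponent q_real_def psi trunc
    using fraction_error_bound[OF that(1), of 1 "N - 1"] that(2)
    by (simp add: diff_mult_distrib2 del: sum.lessThan_Suc)
  show ?thesis
    unfolding c_def[symmetric]
    by (intro conjI ballI allI impI; (elim conjE)?;
        rule fps_sums num trunc_nonzero summable uniform hol psi_nonzero analytic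
          inverse_error error; assumption)
qed

end
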